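(* With fixed parameters $q,T$, HP1 performs better than QP and TP1 in terms of average order delay. That is, letting $AOD_{HP1}$, $AOD_{QP}$, $AOD_{TP1}$ denote the average order delays of HP1 with parameters $(q,T)$, QP with parameter $q$, and TP1 with parameter $T$, $$AOD_{HP1}<AOD_{QP}\quad\text{and}\quad AOD_{HP1}<AOD_{TP1}.$$
   Context: Customer orders arrive according to a Poisson process $\{N(t)\}_{t\ge 0}$ with rate $\lambda>0$ and $N(0)=0$; $\tau_n$ denotes the arrival time of the $n$-th order, and $a\wedge b=\min(a,b)$. A renewal-type clearing policy is specified by its shipment-release time $\tau$ (the length of one consolidation cycle started at time $0$), a stopping time of the natural filtration of $N$ with $0<\mathbb{E}[\tau]<\infty$. Its average order delay is $AOD_\tau=\mathbb{E}\left[\int_0^\tau N(u)\,du\right]/(\lambda\,\mathbb{E}[\tau])$; a policy performs better than another in terms of average order delay if its average order delay is smaller. The policies are: QP with parameter $q$ (an integer, $q\ge1$): $\tau=\tau_q$; TP1 with parameter $T>0$: $\tau=T$; HP1 with parameters $q$ (an integer, $q\ge1$) and $T>0$: $\tau=\tau_q\wedge T$.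
   Formalization: The comparison of HP1 with QP is stated only for q ≥ 2: for q = 1 both average order delays are 0, so the strict inequality fails. The comparison with TP1 is stated for all q ≥ 1. *)

theory Defs
  imports "HOL-Probability.Probability"
begin

text \<open>Sample-path conditions are imposed at every outcome; that all jumps have size one is then an
  almost sure consequence of the Poisson increments. Subtraction on \<^typ>\<open>nat\<close> is harmless
  because paths are nondecreasing.\<close>

locale poisson_process = prob_space M for M :: "'a measure" +
  fixes N :: "real \<Rightarrow> 'a \<Rightarrow> nat" and rate :: real
  assumes rate_pos: "0 < rate"
    and measurable_N: "\<And>t. 0 \<le> t \<Longrightarrow> N t \<in> measurable M (count_space UNIV)"
    and N_0: "\<And>\<omega>. \<omega> \<in> space M \<Longrightarrow> N 0 \<omega> = 0"
    and mono_N: "\<And>\<omega> s t. \<omega> \<in> space M \<Longrightarrow> 0 \<le> s \<Longrightarrow> s \<le> t \<Longrightarrow> N s \<omega> \<le> N t \<omega>"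
    and right_continuous_N:
      "\<And>\<omega> t. \<omega> \<in> space M \<Longrightarrow> 0 \<le> t \<Longrightarrow> continuous (at_right t) (\<lambda>s. N s \<omega>)"
    and indep_increments:
      "\<And>(t :: nat \<Rightarrow> real) n. 0 \<le> t 0 \<Longrightarrow> (\<And>i. i < n \<Longrightarrow> t i \<le> t (Suc i)) \<Longrightarrow>
        indep_vars (\<lambda>_. count_space UNIV) (\<lambda>i \<omega>. N (t (Suc i)) \<omega> - N (t i) \<omega>) {..<n}"
    and poisson_increments:
      "\<And>s t. 0 \<le> s \<Longrightarrow> s < t \<Longrightarrow>
        distr M (count_space UNIV) (\<lambda>\<omega>. N t \<omega> - N s \<omega>) = measure_pmf (poisson_pmf (rate * (t - s)))"

text \<open>Times are valued in \<^typ>\<open>ennreal\<close>, so the arrival time is \<open>\<infinity>\<close> (the infimum of the empty set)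
  on the null event that fewer than \<open>n\<close> orders ever arrive.\<close>

definition arrival_time :: "(real \<Rightarrow> 'a \<Rightarrow> nat) \<Rightarrow> nat \<Rightarrow> 'a \<Rightarrow> ennreal" where
  "arrival_time N n \<omega> = (INF t\<in>{t. 0 \<le> t \<and> n \<le> N t \<omega>}. ennreal t)"

definition avg_order_delay ::
    "'a measure \<Rightarrow> (real \<Rightarrow> 'a \<Rightarrow> nat) \<Rightarrow> real \<Rightarrow> ('a \<Rightarrow> ennreal) \<Rightarrow> ennreal" where
  "avg_order_delay M N rate \<tau> =
    (\<integral>\<^sup>+\<omega>. (\<integral>\<^sup>+u\<in>{u. 0 \<le> u \<and> ennreal u \<le> \<tau> \<omega>}. of_nat (N u \<omega>) \<partial>lborel) \<partial>M)
      / (ennreal rate * (\<integral>\<^sup>+\<omega>. \<tau> \<omega> \<partial>M))"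

definition QP :: "(real \<Rightarrow> 'a \<Rightarrow> nat) \<Rightarrow> nat \<Rightarrow> 'a \<Rightarrow> ennreal" where
  "QP N q \<omega> = arrival_time N q \<omega>"

definition TP1 :: "real \<Rightarrow> 'a \<Rightarrow> ennreal" where
  "TP1 T \<omega> = ennreal T"

definition HP1 :: "(real \<Rightarrow> 'a \<Rightarrow> nat) \<Rightarrow> nat \<Rightarrow> real \<Rightarrow> 'a \<Rightarrow> ennreal" where
  "HP1 N q T \<omega> = min (arrival_time N q \<omega>) (ennreal T)"

text \<open>With \<open>q = 1\<close> every order is shipped on arrival, so QP has no delay at all and no policy can be
  strictly better. A strict comparison with QP is therefore possible only for \<open>q \<ge> 2\<close>.\<close>

lemma avg_order_delay_QP_1: "avg_order_delay M N rate (QP N 1) = 0"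
proof -
  have "(\<integral>\<^sup>+u\<in>{u. 0 \<le> u \<and> ennreal u \<le> QP N 1 \<omega>}. of_nat (N u \<omega>) \<partial>lborel) = 0" for \<omega>
  proof -
    have *: "N u \<omega> = 0"
      if "u \<noteq> enn2real (QP N 1 \<omega>)" "0 \<le> u" "ennreal u \<le> QP N 1 \<omega>" for u
    proof (rule ccontr)
      assume "N u \<omega> \<noteq> 0"
      hence "QP N 1 \<omega> \<le> ennreal u"
        using that(2) unfolding QP_def arrival_time_def by (intro INF_lower) auto
      hence "QP N 1 \<omega> = ennreal u" using that(3) by auto
      thus False using that(1,2) by simp
    qed
    have "AE u in lborel. u \<noteq> enn2real (QP N 1 \<omega>)"
      by (rule AE_lborel_singleton)
    hence "AE u in lborel. of_nat (N u \<omega>) * indicator {u. 0 \<le> u \<and> ennreal u \<le> QP N 1 \<omega>} u = (0::ennreal)"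
      by eventually_elim (use * in \<open>fastforce simp: indicator_def\<close>)
    thus ?thesis by (subst nn_integral_cong_AE) auto
  qed
  thus ?thesis unfolding avg_order_delay_def by simp
qed

end

theory Submission imports Defs begin

text \<open>
  Call \<open>N u\<close> the level at time \<open>u\<close>. Up to the factor \<open>1 / rate\<close>, the average order delay of a
  policy is the mean level over one cycle, each level \<open>k\<close> being weighted by the expected time that
  the cycle spends there. All three policies spend this time on sets of the form
  \<open>{u \<in> I. N u < q}\<close>: up to a single instant, \<open>u \<le> \<tau>\<^sub>q\<close> means \<open>N u < q\<close>, so QP corresponds to the
  time window \<open>I = {0..}\<close>, HP1 to \<open>I = {0..T}\<close>, and TP1 to \<open>I = {0..T}\<close> without the bound on
  the level. By Tonelli only the one-dimensional laws of \<open>N\<close> matter: the expected time at level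
  \<open>k\<close> within \<open>I\<close> is the integral over \<open>I\<close> of the Poisson probability of \<open>k\<close>, which as a function of
  \<open>u\<close> is an Erlang density divided by \<open>rate\<close> (lemma \<open>occupation_time_level\<close>). Hence it equals
  \<open>1 / rate\<close> on \<open>{0..}\<close> and \<open>c k / rate\<close> on \<open>{0..T}\<close>, where \<open>c k\<close> is the Erlang distribution function
  at \<open>T\<close>, that is, the probability that more than \<open>k\<close> orders arrive before \<open>T\<close>.

  HP1 against QP: both average the levels \<open>0, \<dots>, q - 1\<close>, QP with equal weights and HP1 with the
  weights \<open>c k\<close>, which decrease strictly in \<open>k\<close>. Favouring the low levels lowers the mean as soon as
  there are two levels (lemma \<open>decreasing_weights_lower_mean\<close>).

  HP1 against TP1: within \<open>{0..T}\<close> TP1 counts all the time that HP1 counts and, in addition, an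
  expected time \<open>R > 0\<close> at levels of at least \<open>q\<close>. The mean level of HP1 is below \<open>q\<close>, so adding this
  time raises the mean.
\<close>

section \<open>Weighted means and Erlang distribution functions\<close>

text \<open>The difference of the two sides, as a function of \<open>q\<close>, grows by \<open>(\<Sum>k<q. (c k - c q)) > 0\<close> when
  \<open>q\<close> is increased by one; this makes an induction work without pairing the terms \<open>k\<close> and
  \<open>q - 1 - k\<close>.\<close>

lemma decreasing_weights_lower_mean:
  fixes c :: "nat \<Rightarrow> real"
  assumes "2 \<le> q" and "\<And>i j. i < j \<Longrightarrow> j < q \<Longrightarrow> c j < c i"
  shows "2 * (\<Sum>k<q. real k * c k) < (real q - 1) * (\<Sum>k<q. c k)"
  using assms
proof (induction q rule: dec_induct)
  case base
  have "c 1 < c 0" using base(1)[of 0 1] by simp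
  then show ?case by (simp add: numeral_2_eq_2)
next
  case (step n)
  have "(\<Sum>k<n. c n) < (\<Sum>k<n. c k)"
    using step(1) step(4) by (intro sum_strict_mono) (auto simp: lessThan_empty_iff)
  then have "real n * c n < (\<Sum>k<n. c k)" by simp
  moreover have "2 * (\<Sum>k<n. real k * c k) < (real n - 1) * (\<Sum>k<n. c k)"
    using step(3) step(4) by simp
  ultimately show ?case by (simp add: algebra_simps)
qed

text \<open>The complement of the distribution function is a partial sum of Poisson probabilities, and a
  larger shape parameter adds positive terms to it.\<close>

lemma erlang_CDF_strict_decreasing_in_shape:
  assumes "0 < l" "0 < x" "i < j"
  shows "erlang_CDF j l x < erlang_CDF i l x"
proof -
  have "(\<Sum>n\<le>i. ((l * x)^n * exp (- l * x) / fact n)) < (\<Sum>n\<le>j. ((l * x)^n * exp (- l * x) / fact n))"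
    using assms by (intro sum_strict_mono2[of _ _ j]) auto
  then show ?thesis using assms by (simp add: erlang_CDF_def)
qed

lemma erlang_CDF_pos:
  assumes "0 < l" "0 < x"
  shows "0 < erlang_CDF k l x"
  using erlang_CDF_strict_decreasing_in_shape[OF assms, of k "Suc k"] erlang_CDF_nonneg[OF assms(1), of "Suc k" x]
  by linarith

section \<open>Expected time spent at a level\<close>

text \<open>Expresses a release time, possibly infinite, as an integral over the cycle, so that the expected
  cycle length and the expected accumulated delay can be computed by the same formula.\<close>

lemma emeasure_lborel_initial_segment:
  "emeasure lborel {u::real. 0 \<le> u \<and> ennreal u \<le> x} = x"
proof (cases x)
  case (real r)
  then have "{u::real. 0 \<le> u \<and> ennreal u \<le> x} = {0..r}" by auto
  with real show ?thesis by simp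
next
  case top
  then have "{u::real. 0 \<le> u \<and> ennreal u \<le> x} = {0..}" by auto
  moreover have "emeasure lborel {0::real..} = \<infinity>"
  proof -
    have "of_nat n \<le> emeasure lborel {0::real..}" for n
      using emeasure_mono[of "{0..real n}" "{0..}" lborel] by (simp add: ennreal_of_nat_eq_real_of_nat)
    then show ?thesis
      using ennreal_Ex_less_of_nat by (metis infinity_ennreal_def less_le_not_le top.not_eq_extremum)
  qed
  ultimately show ?thesis using top by simp
qed

text \<open>A set of levels is allowed, not only one level, because TP1 visits infinitely many levels
  \<open>{q..}\<close> whose contribution need not be split.\<close>

definition occupation_time ::
    "'a measure \<Rightarrow> (real \<Rightarrow> 'a \<Rightarrow> nat) \<Rightarrow> real set \<Rightarrow> nat set \<Rightarrow> ennreal" where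
  "occupation_time M N I K = (\<integral>\<^sup>+\<omega>. (\<integral>\<^sup>+u\<in>I. indicator K (N u \<omega>) \<partial>lborel) \<partial>M)"

context poisson_process
begin

text \<open>Joint measurability, needed for Tonelli, comes from right continuity: the time argument is
  approximated from the right by points of the grid of mesh \<open>1 / (i + 1)\<close>, which is countable. Times
  are truncated at \<open>0\<close> because nothing is assumed about \<open>N\<close> at negative times.\<close>

lemma measurable_path_pair:
  "(\<lambda>(u, \<omega>). N (max 0 u) \<omega>) \<in> measurable (lborel \<Otimes>\<^sub>M M) (count_space UNIV)"
proof -
  \<comment> \<open>The next grid point strictly to the right of \<open>max 0 u\<close>; strictness is what \<open>at_right\<close> asks for.\<close>
  define s where "s i u = (real_of_int \<lfloor>real (Suc i) * max 0 u\<rfloor> + 1) / real (Suc i)" for i and u :: real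
  have s_gt: "max 0 u < s i u" for i u
  proof -
    have "real (Suc i) * max 0 u < real_of_int \<lfloor>real (Suc i) * max 0 u\<rfloor> + 1" by linarith
    then show ?thesis unfolding s_def by (subst pos_less_divide_eq) (simp_all add: mult.commute)
  qed
  have s_le: "s i u \<le> max 0 u + 1 / real (Suc i)" for i u
  proof -
    have "s i u \<le> (real (Suc i) * max 0 u + 1) / real (Suc i)"
      unfolding s_def by (intro divide_right_mono) linarith+
    also have "\<dots> = max 0 u + 1 / real (Suc i)"
      by (simp only: add_divide_distrib) simp
    finally show ?thesis .
  qed
  have s_lim: "(\<lambda>i. s i u) \<longlonglongrightarrow> max 0 u" for u
  proof (rule tendsto_sandwich)
    show "(\<lambda>i. max 0 u) \<longlonglongrightarrow> max 0 u" by simp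
    show "(\<lambda>i. max 0 u + 1 / real (Suc i)) \<longlonglongrightarrow> max 0 u"
      using tendsto_add[OF tendsto_const[of "max 0 u"] LIMSEQ_inverse_real_of_nat]
      by (simp add: inverse_eq_divide)
  qed (use s_gt s_le in \<open>auto intro!: always_eventually less_imp_le\<close>)
  have lim: "(\<lambda>i. real (N (s i u) \<omega>)) \<longlonglongrightarrow> real (N (max 0 u) \<omega>)" if "\<omega> \<in> space M" for u \<omega>
  proof -
    have "((\<lambda>v. N v \<omega>) \<longlongrightarrow> N (max 0 u) \<omega>) (at_right (max 0 u))"
      using right_continuous_N[OF that, of "max 0 u"] by (simp add: continuous_within)
    moreover have "filterlim (\<lambda>i. s i u) (at_right (max 0 u)) sequentially"
      using s_lim[of u] less_imp_neq[OF s_gt, of u, symmetric] s_gt[of u]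
      by (simp only: filterlim_at) (auto intro!: always_eventually)
    ultimately have "(\<lambda>i. N (s i u) \<omega>) \<longlonglongrightarrow> N (max 0 u) \<omega>"
      by (rule filterlim_compose)
    then have "\<forall>\<^sub>F i in sequentially. N (s i u) \<omega> = N (max 0 u) \<omega>"
      by (simp add: tendsto_discrete)
    then show ?thesis
      by (intro tendsto_eventually) (auto elim: eventually_mono)
  qed
  have meas: "(\<lambda>p. N (s i (fst p)) (snd p)) \<in> measurable (lborel \<Otimes>\<^sub>M M) (count_space UNIV)" for i
  proof -
    have "(\<lambda>p. N (max 0 ((real_of_int z + 1) / real (Suc i))) (snd p)) \<in> measurable (lborel \<Otimes>\<^sub>M M) (count_space UNIV)" for z
      by (rule measurable_compose[OF measurable_snd measurable_N]) simp
    moreover have "(\<lambda>p. \<lfloor>real (Suc i) * max 0 (fst p)\<rfloor>) \<in> measurable (lborel \<Otimes>\<^sub>M M) (count_space UNIV)"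
      by measurable
    ultimately have "(\<lambda>p. N (max 0 ((real_of_int \<lfloor>real (Suc i) * max 0 (fst p)\<rfloor> + 1) / real (Suc i))) (snd p))
        \<in> measurable (lborel \<Otimes>\<^sub>M M) (count_space UNIV)"
      by (rule measurable_compose_countable)
    moreover have "max 0 (s i u) = s i u" for u using s_gt[of u i] by linarith
    ultimately show ?thesis unfolding s_def by simp
  qed
  have "(\<lambda>p. real (N (max 0 (fst p)) (snd p))) \<in> borel_measurable (lborel \<Otimes>\<^sub>M M)"
  proof (rule borel_measurable_LIMSEQ_real)
    show "(\<lambda>i. real (N (s i (fst p)) (snd p))) \<longlonglongrightarrow> real (N (max 0 (fst p)) (snd p))"
      if "p \<in> space (lborel \<Otimes>\<^sub>M M)" for p
      using that by (intro lim) (auto simp: space_pair_measure)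
    show "(\<lambda>p. real (N (s i (fst p)) (snd p))) \<in> borel_measurable (lborel \<Otimes>\<^sub>M M)" for i
      by (rule measurable_compose[OF meas]) simp
  qed
  then have "(\<lambda>p. nat \<lfloor>real (N (max 0 (fst p)) (snd p))\<rfloor>) \<in> measurable (lborel \<Otimes>\<^sub>M M) (count_space UNIV)"
    by measurable
  then show ?thesis by (simp add: case_prod_beta')
qed

lemma measurable_functional_of_path:
  fixes g :: "nat \<Rightarrow> ennreal"
  assumes [measurable]: "I \<in> sets borel" and I: "I \<subseteq> {0..}"
  shows "(\<lambda>(u, \<omega>). g (N u \<omega>) * indicator I u) \<in> borel_measurable (lborel \<Otimes>\<^sub>M M)"
proof -
  note measurable_path_pair[measurable]
  have "(\<lambda>p. g ((\<lambda>(u, \<omega>). N (max 0 u) \<omega>) p) * indicator I (fst p)) \<in> borel_measurable (lborel \<Otimes>\<^sub>M M)"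
    by measurable
  moreover have "(\<lambda>p. g ((\<lambda>(u, \<omega>). N (max 0 u) \<omega>) p) * indicator I (fst p)) = (\<lambda>(u, \<omega>). g (N u \<omega>) * indicator I u)"
    using I by (auto simp: fun_eq_iff indicator_def max_def)
  ultimately show ?thesis by simp
qed

lemma measurable_path_integrand:
  fixes g :: "nat \<Rightarrow> ennreal"
  assumes "I \<in> sets borel" "I \<subseteq> {0..}" "\<omega> \<in> space M"
  shows "(\<lambda>u. g (N u \<omega>) * indicator I u) \<in> borel_measurable lborel"
  using measurable_Pair1[OF measurable_functional_of_path[OF assms(1,2), of g] assms(3)] by simp

lemma measurable_path_integral:
  fixes g :: "nat \<Rightarrow> ennreal"
  assumes "I \<in> sets borel" "I \<subseteq> {0..}"
  shows "(\<lambda>\<omega>. \<integral>\<^sup>+u\<in>I. g (N u \<omega>) \<partial>lborel) \<in> borel_measurable M"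
proof -
  have "(\<lambda>(\<omega>, u). g (N u \<omega>) * indicator I u) \<in> borel_measurable (M \<Otimes>\<^sub>M lborel)"
    using measurable_pair_swap[OF measurable_functional_of_path[OF assms, of g]]
    by (simp add: case_prod_beta')
  then show ?thesis
    by (rule lborel.borel_measurable_nn_integral)
qed

lemma expected_path_integral_add:
  fixes g h :: "nat \<Rightarrow> ennreal"
  assumes I: "I \<in> sets borel" "I \<subseteq> {0..}"
  shows "(\<integral>\<^sup>+\<omega>. (\<integral>\<^sup>+u\<in>I. (g (N u \<omega>) + h (N u \<omega>)) \<partial>lborel) \<partial>M)
    = (\<integral>\<^sup>+\<omega>. (\<integral>\<^sup>+u\<in>I. g (N u \<omega>) \<partial>lborel) \<partial>M) + (\<integral>\<^sup>+\<omega>. (\<integral>\<^sup>+u\<in>I. h (N u \<omega>) \<partial>lborel) \<partial>M)"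
proof -
  have "(\<integral>\<^sup>+\<omega>. (\<integral>\<^sup>+u\<in>I. (g (N u \<omega>) + h (N u \<omega>)) \<partial>lborel) \<partial>M)
     = (\<integral>\<^sup>+\<omega>. (\<integral>\<^sup>+u\<in>I. g (N u \<omega>) \<partial>lborel) + (\<integral>\<^sup>+u\<in>I. h (N u \<omega>) \<partial>lborel) \<partial>M)"
    by (intro nn_integral_cong)
       (simp only: distrib_right nn_integral_add[OF measurable_path_integrand[OF I] measurable_path_integrand[OF I]])
  then show ?thesis
    by (simp add: nn_integral_add measurable_path_integral[OF I])
qed

lemma expected_path_integral_cmult:
  fixes g :: "nat \<Rightarrow> ennreal"
  assumes I: "I \<in> sets borel" "I \<subseteq> {0..}"
  shows "(\<integral>\<^sup>+\<omega>. (\<integral>\<^sup>+u\<in>I. c * g (N u \<omega>) \<partial>lborel) \<partial>M) = c * (\<integral>\<^sup>+\<omega>. (\<integral>\<^sup>+u\<in>I. g (N u \<omega>) \<partial>lborel) \<partial>M)"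
proof -
  have "(\<integral>\<^sup>+\<omega>. (\<integral>\<^sup>+u\<in>I. c * g (N u \<omega>) \<partial>lborel) \<partial>M) = (\<integral>\<^sup>+\<omega>. c * (\<integral>\<^sup>+u\<in>I. g (N u \<omega>) \<partial>lborel) \<partial>M)"
    by (intro nn_integral_cong)
       (simp only: mult.assoc nn_integral_cmult[OF measurable_path_integrand[OF I]])
  then show ?thesis
    by (simp add: nn_integral_cmult measurable_path_integral[OF I])
qed

lemma expected_path_integral_levels:
  fixes g :: "nat \<Rightarrow> ennreal"
  assumes I: "I \<in> sets borel" "I \<subseteq> {0..}"
  shows "(\<integral>\<^sup>+\<omega>. (\<integral>\<^sup>+u\<in>I. g (N u \<omega>) * indicator {..<q} (N u \<omega>) \<partial>lborel) \<partial>M)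
    = (\<Sum>k<q. g k * occupation_time M N I {k})"
proof (induction q)
  case 0
  show ?case by simp
next
  case (Suc q)
  have "g n * indicator {..<Suc q} n = g n * indicator {..<q} n + g q * indicator {q} n" for n
    by (auto simp: indicator_def)
  then show ?case
    using expected_path_integral_add[OF I, of "\<lambda>n. g n * indicator {..<q} n" "\<lambda>n. g q * indicator {q} n"]
      expected_path_integral_cmult[OF I, of "g q" "indicator {q}"] Suc
    by (simp add: occupation_time_def)
qed

lemma expected_path_integral_levels_real:
  fixes g c :: "nat \<Rightarrow> real"
  assumes I: "I \<in> sets borel" "I \<subseteq> {0..}"
    and occ: "\<And>k. occupation_time M N I {k} = ennreal (c k / rate)"
    and c: "\<And>k. 0 \<le> c k" and g: "\<And>k. 0 \<le> g k"
  shows "(\<integral>\<^sup>+\<omega>. (\<integral>\<^sup>+u\<in>I. ennreal (g (N u \<omega>)) * indicator {..<q} (N u \<omega>) \<partial>lborel) \<partial>M)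
    = ennreal ((\<Sum>k<q. g k * c k) / rate)"
proof -
  have "(\<integral>\<^sup>+\<omega>. (\<integral>\<^sup>+u\<in>I. ennreal (g (N u \<omega>)) * indicator {..<q} (N u \<omega>) \<partial>lborel) \<partial>M)
      = (\<Sum>k<q. ennreal (g k) * ennreal (c k / rate))"
    using expected_path_integral_levels[OF I, of "\<lambda>n. ennreal (g n)" q] by (simp only: occ)
  also have "\<dots> = (\<Sum>k<q. ennreal (g k * c k / rate))"
    using g by (simp add: ennreal_mult'[symmetric])
  also have "\<dots> = ennreal ((\<Sum>k<q. g k * c k) / rate)"
    using g c rate_pos by (subst sum_ennreal) (auto simp: sum_divide_distrib)
  finally show ?thesis .
qed

lemma prob_level:
  assumes "0 < u"
  shows "(\<integral>\<^sup>+\<omega>. indicator {k} (N u \<omega>) \<partial>M) = ennreal (1 / rate) * ennreal (erlang_density k rate u)"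
proof -
  have [measurable]: "N u \<in> measurable M (count_space UNIV)"
    using measurable_N assms by simp
  have "distr M (count_space UNIV) (N u) = distr M (count_space UNIV) (\<lambda>\<omega>. N u \<omega> - N 0 \<omega>)"
    by (intro distr_cong) (auto simp: N_0)
  also have "\<dots> = measure_pmf (poisson_pmf (rate * u))"
    using poisson_increments[of 0 u] assms by simp
  finally have d: "distr M (count_space UNIV) (N u) = measure_pmf (poisson_pmf (rate * u))" .
  have "(\<integral>\<^sup>+\<omega>. indicator {k} (N u \<omega>) \<partial>M) = (\<integral>\<^sup>+n. indicator {k} n \<partial>distr M (count_space UNIV) (N u))"
    using nn_integral_distr[of "N u" M "count_space UNIV" "indicator {k}"] by (simp del: nn_integral_indicator)
  also have "\<dots> = emeasure (measure_pmf (poisson_pmf (rate * u))) {k}"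
    unfolding d by (rule nn_integral_indicator) simp
  also have "\<dots> = ennreal (pmf (poisson_pmf (rate * u)) k)"
    by (rule emeasure_pmf_single)
  also have "\<dots> = ennreal (1 / rate) * ennreal (erlang_density k rate u)"
    using assms rate_pos
    by (simp add: ennreal_mult'[symmetric] erlang_density_def power_mult_distrib)
  finally show ?thesis .
qed

text \<open>The time \<open>0\<close> is discarded as a null set, since the Poisson law is available only for increments
  over intervals of positive length.\<close>

lemma occupation_time_level:
  assumes I: "I \<in> sets borel" "I \<subseteq> {0..}"
  shows "occupation_time M N I {k} = ennreal (1 / rate) * (\<integral>\<^sup>+u\<in>I. ennreal (erlang_density k rate u) \<partial>lborel)"
proof -
  have [measurable]: "I \<in> sets borel" by fact
  interpret P: pair_sigma_finite lborel M by unfold_locales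
  have "occupation_time M N I {k} = (\<integral>\<^sup>+u. (\<integral>\<^sup>+\<omega>. indicator {k} (N u \<omega>) * indicator I u \<partial>M) \<partial>lborel)"
    unfolding occupation_time_def
    by (rule P.Fubini') (rule measurable_functional_of_path[OF I])
  also have "\<dots> = (\<integral>\<^sup>+u. ennreal (1 / rate) * (ennreal (erlang_density k rate u) * indicator I u) \<partial>lborel)"
  proof (rule nn_integral_cong_AE)
    have "AE u in lborel. u \<noteq> (0::real)" by (rule AE_lborel_singleton)
    then show "AE u in lborel. (\<integral>\<^sup>+\<omega>. indicator {k} (N u \<omega>) * indicator I u \<partial>M)
        = ennreal (1 / rate) * (ennreal (erlang_density k rate u) * indicator I u)"
    proof eventually_elim
      case (elim u)
      show ?case
      proof (cases "u \<in> I")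
        case True
        with elim I(2) have "0 < u" by auto
        with True show ?thesis by (simp add: prob_level)
      qed simp
    qed
  qed
  also have "\<dots> = ennreal (1 / rate) * (\<integral>\<^sup>+u\<in>I. ennreal (erlang_density k rate u) \<partial>lborel)"
    by (rule nn_integral_cmult) measurable
  finally show ?thesis .
qed

lemma occupation_time_level_bounded:
  assumes "0 < T"
  shows "occupation_time M N {0..T} {k} = ennreal (erlang_CDF k rate T / rate)"
proof -
  have "(\<integral>\<^sup>+u\<in>{0..T}. ennreal (erlang_density k rate u) \<partial>lborel)
      = (\<integral>\<^sup>+u\<in>{..T}. ennreal (erlang_density k rate u) \<partial>lborel)"
    by (intro nn_integral_cong) (auto simp: erlang_density_def indicator_def)
  then show ?thesis
    using rate_pos by (simp add: occupation_time_level nn_integral_erlang_density ennreal_mult'[symmetric])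
qed

lemma occupation_time_level_unbounded:
  "occupation_time M N {0..} {k} = ennreal (1 / rate)"
proof -
  have "(\<integral>\<^sup>+u\<in>{0..}. ennreal (erlang_density k rate u) \<partial>lborel)
      = (\<integral>\<^sup>+u. ennreal (erlang_density k rate u * u ^ 0) \<partial>lborel)"
    by (intro nn_integral_cong) (auto simp: erlang_density_def indicator_def)
  also have "\<dots> = 1" by (subst nn_integral_erlang_ith_moment[OF rate_pos]) simp
  finally show ?thesis by (simp add: occupation_time_level)
qed

section \<open>Average order delay as a mean level\<close>

text \<open>The exceptional time is the arrival time itself, where \<open>u \<le> \<tau>\<^sub>q\<close> holds although \<open>N u = q\<close>
  is possible. Monotone paths make every other time with \<open>N u < q\<close> precede the arrival.\<close>

lemma AE_before_arrival_time:
  assumes "\<omega> \<in> space M"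
  shows "AE u in lborel. 0 \<le> u \<and> ennreal u \<le> arrival_time N q \<omega> \<longleftrightarrow> 0 \<le> u \<and> N u \<omega> < q"
proof -
  have "AE u in lborel. u \<noteq> enn2real (arrival_time N q \<omega>)" by (rule AE_lborel_singleton)
  then show ?thesis
  proof eventually_elim
    case (elim u)
    have "N u \<omega> < q" if "0 \<le> u" "ennreal u \<le> arrival_time N q \<omega>"
    proof (rule ccontr)
      assume "\<not> N u \<omega> < q"
      then have "arrival_time N q \<omega> \<le> ennreal u"
        using that unfolding arrival_time_def by (intro INF_lower) auto
      then have "arrival_time N q \<omega> = ennreal u" using that by auto
      then show False using elim that by simp
    qed
    moreover have "ennreal u \<le> arrival_time N q \<omega>" if "0 \<le> u" "N u \<omega> < q"
      unfolding arrival_time_def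
    proof (rule INF_greatest)
      fix t assume "t \<in> {t. 0 \<le> t \<and> q \<le> N t \<omega>}"
      then have "\<not> t \<le> u" using mono_N[OF assms, of t u] that by auto
      then show "ennreal u \<le> ennreal t" by (simp add: ennreal_leI)
    qed
    ultimately show ?case by blast
  qed
qed

text \<open>Numerator and denominator are both integrals of a function of the level over the cycle, with
  \<open>g k = k\<close> and \<open>g k = 1\<close>. Once the cycle is known to consist of the times in \<open>I\<close> at levels below
  \<open>q\<close>, both are finite sums over levels, and the common factor \<open>1 / rate\<close> of the occupation times
  cancels.\<close>

lemma avg_order_delay_via_levels:
  assumes I: "I \<in> sets borel" "I \<subseteq> {0..}"
    and cycle: "\<And>\<omega>. \<omega> \<in> space M \<Longrightarrow>
      AE u in lborel. 0 \<le> u \<and> ennreal u \<le> \<tau> \<omega> \<longleftrightarrow> u \<in> I \<and> N u \<omega> < q"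
    and occ: "\<And>k. occupation_time M N I {k} = ennreal (c k / rate)"
    and c: "\<And>k. 0 < c k" and q: "1 \<le> q"
  shows "avg_order_delay M N rate \<tau> = ennreal ((\<Sum>k<q. real k * c k) / (rate * (\<Sum>k<q. c k)))"
proof -
  have *: "(\<integral>\<^sup>+\<omega>. (\<integral>\<^sup>+u\<in>{u. 0 \<le> u \<and> ennreal u \<le> \<tau> \<omega>}. ennreal (g (N u \<omega>)) \<partial>lborel) \<partial>M)
      = ennreal ((\<Sum>k<q. g k * c k) / rate)" if g: "\<And>k. 0 \<le> g k" for g :: "nat \<Rightarrow> real"
  proof -
    have "(\<integral>\<^sup>+\<omega>. (\<integral>\<^sup>+u\<in>{u. 0 \<le> u \<and> ennreal u \<le> \<tau> \<omega>}. ennreal (g (N u \<omega>)) \<partial>lborel) \<partial>M)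
      = (\<integral>\<^sup>+\<omega>. (\<integral>\<^sup>+u\<in>I. ennreal (g (N u \<omega>)) * indicator {..<q} (N u \<omega>) \<partial>lborel) \<partial>M)"
    proof (rule nn_integral_cong, rule nn_integral_cong_AE)
      fix \<omega> assume "\<omega> \<in> space M"
      from cycle[OF this] show "AE u in lborel. ennreal (g (N u \<omega>)) * indicator {u. 0 \<le> u \<and> ennreal u \<le> \<tau> \<omega>} u
          = ennreal (g (N u \<omega>)) * indicator {..<q} (N u \<omega>) * indicator I u"
        by eventually_elim (auto simp: indicator_def)
    qed
    also have "\<dots> = ennreal ((\<Sum>k<q. g k * c k) / rate)"
      using c[THEN less_imp_le] g by (rule expected_path_integral_levels_real[OF I occ])
    finally show ?thesis .
  qed
  have "(\<integral>\<^sup>+\<omega>. \<tau> \<omega> \<partial>M) = ennreal ((\<Sum>k<q. c k) / rate)"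
    using *[of "\<lambda>_. 1"] by (simp add: emeasure_lborel_initial_segment)
  moreover have "0 < (\<Sum>k<q. c k)" using c q by (intro sum_pos) (auto simp: lessThan_empty_iff)
  moreover have "0 \<le> (\<Sum>k<q. real k * c k)" using c[THEN less_imp_le] by (intro sum_nonneg) simp
  ultimately show ?thesis
    unfolding avg_order_delay_def using *[of real] rate_pos
    by (simp add: ennreal_mult'[symmetric] divide_ennreal ennreal_of_nat_eq_real_of_nat)
qed

lemma avg_order_delay_QP:
  assumes "1 \<le> q"
  shows "avg_order_delay M N rate (QP N q) = ennreal ((\<Sum>k<q. real k) / (rate * real q))"
  using avg_order_delay_via_levels[of "{0..}" "QP N q" q "\<lambda>_. 1"] assms
  by (simp add: AE_before_arrival_time occupation_time_level_unbounded QP_def)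

lemma avg_order_delay_HP1:
  assumes "1 \<le> q" "0 < T"
  shows "avg_order_delay M N rate (HP1 N q T) =
    ennreal ((\<Sum>k<q. real k * erlang_CDF k rate T) / (rate * (\<Sum>k<q. erlang_CDF k rate T)))"
proof (rule avg_order_delay_via_levels[of "{0..T}"])
  fix \<omega> assume "\<omega> \<in> space M"
  from AE_before_arrival_time[OF this, of q]
  show "AE u in lborel. 0 \<le> u \<and> ennreal u \<le> HP1 N q T \<omega> \<longleftrightarrow> u \<in> {0..T} \<and> N u \<omega> < q"
    by eventually_elim (use assms in \<open>auto simp: HP1_def\<close>)
qed (use assms rate_pos in \<open>auto simp: occupation_time_level_bounded erlang_CDF_pos\<close>)

section \<open>Comparison of the policies\<close>

lemma HP1_less_QP:
  assumes "2 \<le> q" "0 < T"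
  shows "avg_order_delay M N rate (HP1 N q T) < avg_order_delay M N rate (QP N q)"
proof -
  define c where "c k = erlang_CDF k rate T" for k
  have c_pos: "0 < c k" for k unfolding c_def using erlang_CDF_pos rate_pos assms by simp
  have S: "0 < (\<Sum>k<q. c k)" using c_pos assms by (intro sum_pos) (auto simp: lessThan_empty_iff)
  have gauss: "2 * (\<Sum>k<n. real k) = real n * (real n - 1)" for n
    by (induction n) (auto simp: algebra_simps)
  have less: "2 * (\<Sum>k<q. real k * c k) < (real q - 1) * (\<Sum>k<q. c k)"
    using assms rate_pos
    by (intro decreasing_weights_lower_mean) (auto simp: c_def erlang_CDF_strict_decreasing_in_shape)
  have "2 * ((\<Sum>k<q. real k * c k) * real q) < (real q * (real q - 1)) * (\<Sum>k<q. c k)"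
    using mult_strict_left_mono[OF less, of "real q"] assms by (simp add: ac_simps)
  then have "(\<Sum>k<q. real k * c k) * real q < (\<Sum>k<q. real k) * (\<Sum>k<q. c k)"
    unfolding gauss[symmetric] by simp
  then have "(\<Sum>k<q. real k * c k) / (rate * (\<Sum>k<q. c k)) < (\<Sum>k<q. real k) / (rate * real q)"
    using S rate_pos assms by (simp add: divide_simps ac_simps)
  moreover have "0 \<le> (\<Sum>k<q. real k * c k) / (rate * (\<Sum>k<q. c k))"
    using c_pos[THEN less_imp_le] rate_pos by (intro divide_nonneg_nonneg sum_nonneg mult_nonneg_nonneg) auto
  ultimately show ?thesis
    using assms by (simp add: avg_order_delay_QP avg_order_delay_HP1 c_def ennreal_less_iff)
qed

text \<open>\<open>A\<close> and \<open>S\<close> are the expected accumulated delay and the expected length of an HP1 cycle, and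
  \<open>R\<close> is the expected time in \<open>{0..T}\<close> at levels of at least \<open>q\<close>. TP1 has cycle length \<open>S + R\<close> and
  accumulates a delay of at least \<open>A + q * R\<close>, so the claim follows from \<open>A < q * S\<close> and \<open>R > 0\<close>.\<close>

lemma HP1_less_TP1:
  assumes "1 \<le> q" "0 < T"
  shows "avg_order_delay M N rate (HP1 N q T) < avg_order_delay M N rate (TP1 T)"
proof -
  let ?I = "{0..T}"
  have I: "?I \<in> sets borel" "?I \<subseteq> {0..}" by auto
  define c where "c k = erlang_CDF k rate T" for k
  define A where "A = (\<Sum>k<q. real k * c k) / rate"
  define S where "S = (\<Sum>k<q. c k) / rate"
  define R where "R = T - S"
  have c_pos: "0 < c k" for k unfolding c_def using erlang_CDF_pos rate_pos assms by simp
  have occ: "occupation_time M N ?I {k} = ennreal (c k / rate)" for k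
    using assms by (simp add: occupation_time_level_bounded c_def)
  have level_sum: "(\<integral>\<^sup>+\<omega>. (\<integral>\<^sup>+u\<in>?I. ennreal (g (N u \<omega>)) * indicator {..<q} (N u \<omega>) \<partial>lborel) \<partial>M)
      = ennreal ((\<Sum>k<q. g k * c k) / rate)" if "\<And>k. 0 \<le> g k" for g :: "nat \<Rightarrow> real"
    using c_pos[THEN less_imp_le] that by (rule expected_path_integral_levels_real[OF I occ])
  have S_pos: "0 < S"
    unfolding S_def using c_pos assms rate_pos by (intro divide_pos_pos sum_pos) (auto simp: lessThan_empty_iff)
  have A_nonneg: "0 \<le> A"
    unfolding A_def using c_pos[THEN less_imp_le] rate_pos by (intro divide_nonneg_nonneg sum_nonneg) auto
  have A_less: "A < real q * S"
  proof -
    have "(\<Sum>k<q. real k * c k) < (\<Sum>k<q. real q * c k)"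
      using assms c_pos by (intro sum_strict_mono) (auto simp: lessThan_empty_iff)
    then show ?thesis unfolding A_def S_def using rate_pos by (simp add: sum_distrib_left divide_strict_right_mono)
  qed
  have split: "ennreal T = ennreal S + occupation_time M N ?I {q..}"
  proof -
    have "ennreal T = (\<integral>\<^sup>+\<omega>. (\<integral>\<^sup>+u\<in>?I. (indicator {..<q} (N u \<omega>) + indicator {q..} (N u \<omega>)) \<partial>lborel) \<partial>M)"
    proof -
      have "indicator {..<q} n + indicator {q..} n = (1::ennreal)" for n by (auto simp: indicator_def)
      then show ?thesis using assms by (simp add: emeasure_space_1)
    qed
    then show ?thesis
      using level_sum[of "\<lambda>_. 1"]
      by (simp add: expected_path_integral_add[OF I] occupation_time_def S_def)
  qed
  then have R: "occupation_time M N ?I {q..} = ennreal R"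
  proof -
    have "ennreal T - ennreal S = occupation_time M N ?I {q..}" unfolding split by simp
    then show ?thesis using S_pos by (simp add: R_def ennreal_minus)
  qed
  \<comment> \<open>The single level \<open>q\<close> already takes a positive expected time before \<open>T\<close>.\<close>
  have "occupation_time M N ?I {q} \<le> occupation_time M N ?I {q..}"
    unfolding occupation_time_def by (intro nn_integral_mono) (auto simp: indicator_def)
  then have "0 < ennreal R"
    unfolding R[symmetric] occ using c_pos[of q] rate_pos by (auto intro: less_le_trans[rotated])
  then have R_pos: "0 < R" by simp
  have "ennreal A + of_nat q * occupation_time M N ?I {q..}
     = (\<integral>\<^sup>+\<omega>. (\<integral>\<^sup>+u\<in>?I. (ennreal (real (N u \<omega>)) * indicator {..<q} (N u \<omega>) + of_nat q * indicator {q..} (N u \<omega>)) \<partial>lborel) \<partial>M)"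
    using level_sum[of real]
      expected_path_integral_add[OF I, of "\<lambda>n. ennreal (real n) * indicator {..<q} n" "\<lambda>n. of_nat q * indicator {q..} n"]
      expected_path_integral_cmult[OF I, of "of_nat q" "indicator {q..}"]
    by (simp only: occupation_time_def A_def of_nat_0_le_iff)
  also have "\<dots> \<le> (\<integral>\<^sup>+\<omega>. (\<integral>\<^sup>+u\<in>?I. of_nat (N u \<omega>) \<partial>lborel) \<partial>M)"
    by (intro nn_integral_mono) (auto simp: indicator_def ennreal_of_nat_eq_real_of_nat)
  finally have num: "ennreal (A + real q * R) \<le> (\<integral>\<^sup>+\<omega>. (\<integral>\<^sup>+u\<in>?I. of_nat (N u \<omega>) \<partial>lborel) \<partial>M)"
    using A_nonneg R_pos by (simp add: R ennreal_of_nat_eq_real_of_nat ennreal_mult'[symmetric])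
  have "A / (rate * S) < (A + real q * R) / (rate * T)"
  proof -
    have "A * T = A * S + A * R" by (simp add: R_def algebra_simps)
    also have "\<dots> < A * S + real q * S * R" using A_less R_pos by simp
    finally have "A * T < (A + real q * R) * S" by (simp add: algebra_simps)
    then show ?thesis using S_pos assms rate_pos by (simp add: divide_simps ac_simps)
  qed
  moreover have "avg_order_delay M N rate (HP1 N q T) = ennreal (A / (rate * S))"
    using assms rate_pos by (simp add: avg_order_delay_HP1 A_def S_def c_def)
  ultimately have "avg_order_delay M N rate (HP1 N q T) < ennreal ((A + real q * R) / (rate * T))"
    using A_nonneg S_pos rate_pos by (simp add: ennreal_less_iff)
  also have "\<dots> = ennreal (A + real q * R) / (ennreal rate * ennreal T)"
    using A_nonneg R_pos assms rate_pos
    by (simp add: ennreal_mult'[symmetric] divide_ennreal del: ennreal_plus)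
  also have "\<dots> \<le> avg_order_delay M N rate (TP1 T)"
  proof -
    have "{u. 0 \<le> u \<and> ennreal u \<le> ennreal T} = ?I" using assms by auto
    then show ?thesis
      unfolding avg_order_delay_def TP1_def using num
      by (simp add: emeasure_space_1 divide_right_mono_ennreal)
  qed
  finally show ?thesis .
qed

end

theorem theorem6p1:
  fixes M :: "'a measure" and N :: "real \<Rightarrow> 'a \<Rightarrow> nat" and rate T :: real and q :: nat
  assumes "poisson_process M N rate"
    and "1 \<le> q"
    and "0 < T"
  shows "(2 \<le> q \<longrightarrow>
           avg_order_delay M N rate (HP1 N q T) < avg_order_delay M N rate (QP N q))
       \<and> avg_order_delay M N rate (HP1 N q T) < avg_order_delay M N rate (TP1 T)"
proof -
  interpret poisson_process M N rate by fact
  show ?thesis using HP1_less_QP HP1_less_TP1 assms by blast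
qed

end
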